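(* Let $G=(V,E,W)$ and $\widetilde G=(\widetilde V,\widetilde E,\widetilde W)$ be weighted, connected graphs with $|V|=|\widetilde V|=n$, and let $\mathbf{M}$ and $\widetilde{\mathbf{M}}$ be invertible real $n\times n$ matrices. Let $\mathcal{J}$ be an indexing set and, for $j\in\mathcal{J}$, let $r_j$ be either a polynomial or the square root of a polynomial. Suppose that $\mathcal{W}^{\mathbf{T}}=\{r_j(\mathbf{T})\}_{j\in\mathcal{J}}$ and $\mathcal{W}^{\widetilde{\mathbf{T}}}=\{r_j(\widetilde{\mathbf{T}})\}_{j\in\mathcal{J}}$ are frames on the unweighted space $\mathbb{R}^n$ with the Euclidean norm, both with upper frame bound $C\le1$. Let $\mathbf{K}=\mathbf{M}^{-1}\mathbf{T}\mathbf{M}$, $\widetilde{\mathbf{K}}=\widetilde{\mathbf{M}}^{-1}\widetilde{\mathbf{T}}\widetilde{\mathbf{M}}$, $\mathcal{W}^{\mathbf{K}}=\{r_j(\mathbf{K})\}_{j\in\mathcal{J}}$ and $\mathcal{W}^{\widetilde{\mathbf{K}}}=\{r_j(\widetilde{\mathbf{K}})\}_{j\in\mathcal{J}}$. Then $$\big\|\mathcal{W}^{\mathbf{K}}-\mathcal{W}^{\widetilde{\mathbf{K}}}\big\|_{\mathbf{M}}^2\le 6\Big(\big\|\mathcal{W}^{\mathbf{T}}-\mathcal{W}^{\widetilde{\mathbf{T}}}\big\|_2^2+\kappa(\mathbf{M},\widetilde{\mathbf{M}})^2\big(\kappa(\mathbf{M},\widetilde{\mathbf{M}})+1\big)^2\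Big).$$
   Context: For a weighted, connected (undirected) graph on $\{0,\dots,n-1\}$ with weighted adjacency matrix $\mathbf{A}$, weighted degree vector $\mathbf{d}$ and $\mathbf{D}=\mathrm{diag}(\mathbf{d})$, let $\mathbf{N}=\mathbf{I}-\mathbf{D}^{-1/2}\mathbf{A}\mathbf{D}^{-1/2}$ have eigenvalues $0=\omega_0<\omega_1\le\dots\le\omega_{n-1}\le 2$ and orthonormal eigenbasis $\mathbf{v}_0,\dots,\mathbf{v}_{n-1}$, and let $\mathbf{V}$ be the orthogonal matrix with columns $\mathbf{v}_i$. Fix a monotonically decreasing $g:[0,2]\to[0,1]$ with $g(0)=1$, $g(2)=0$; put $\lambda_i=g(\omega_i)$, so $1=\lambda_0>\lambda_1\ge\dots\ge\lambda_{n-1}\ge 0$, $\Lambda=\mathrm{diag}(\lambda_0,\dots,\lambda_{n-1})$ and $\mathbf{T}=\mathbf{V}\Lambda\mathbf{V}^T$. Objects with a tilde are the analogous objects for $\widetilde G$ (with the same $g$). If $r$ is a polynomial or the square root of a polynomial (nonnegative at the relevant eigenvalues so that the real root is defined), then $r(\mathbf{T})=\mathbf{V}r(\Lambda)\mathbf{V}^T$ and $r(\mathbf{K})=\mathbf{M}^{-1}\mathbf{V}r(\Lambda)\mathbf{V}^T\mathbf{M}$, with $r$ applied to the diagonal entries of $\Lambda$; similarly with tildes. A countable family $\{\mathbf{B}_i\}$ is a frame on a normed space $(\mathbb{R}^n,\|\cdot\|)$ with bounds $0<c\le C<\infty$ if $c\|\mathbf{x}\|^2\le\sum_i\|\mathbf{B}_i\mathbf{x}\|^2\le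 C\|\mathbf{x}\|^2$ for all $\mathbf{x}$. $\|\mathbf{x}\|_{\mathbf{M}}=\|\mathbf{M}\mathbf{x}\|_2$. For a family, $\|\{\mathbf{B}_i\}\|_{\mathbf{M}}=\sup_{\|\mathbf{x}\|_{\mathbf{M}}=1}(\sum_i\|\mathbf{B}_i\mathbf{x}\|_{\mathbf{M}}^2)^{1/2}$, and $\|\{\mathbf{B}_i\}\|_2$ is the same with the Euclidean norm; differences of families are elementwise. With $\mathbf{R}_1=\mathbf{M}^{-1}\widetilde{\mathbf{M}}$ and $\mathbf{R}_2=\widetilde{\mathbf{M}}\mathbf{M}^{-1}$, $\kappa(\mathbf{M},\widetilde{\mathbf{M}})=\max_{i=1,2}\max\{\|\mathbf{I}-\mathbf{R}_i\|_2,\|\mathbf{I}-\mathbf{R}_i^{-1}\|_2\}$ (Euclidean operator norms). *)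

theory Defs
  imports "HOL-Analysis.Analysis" "HOL-Computational_Algebra.Polynomial"
begin

text \<open>Graphs on \<open>n\<close> vertices have vertex set \<open>UNIV :: 'n set\<close>, with \<open>n = CARD('n)\<close>, and are given by
  their weighted adjacency matrix: there is an edge between \<open>i\<close> and \<open>j\<close>, of weight \<open>A $ i $ j\<close>,
  iff that entry is positive. Loops are not excluded.\<close>

definition weighted_connected_graph :: "real^'n^'n \<Rightarrow> bool" where
  "weighted_connected_graph A \<longleftrightarrow>
     transpose A = A \<and> (\<forall>i j. 0 \<le> A $ i $ j) \<and>
     (\<forall>i j. (i, j) \<in> {(k, l). 0 < A $ k $ l}\<^sup>*)"

definition weighted_degree :: "real^'n^'n \<Rightarrow> 'n \<Rightarrow> real" where
  "weighted_degree A i = (\<Sum>j\<in>UNIV. A $ i $ j)"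

definition diag_matrix :: "('n \<Rightarrow> real) \<Rightarrow> real^'n^'n" where
  "diag_matrix f = (\<chi> i j. if i = j then f i else 0)"

definition normalized_laplacian :: "real^'n^'n \<Rightarrow> real^'n^'n" where
  "normalized_laplacian A =
     (let S = diag_matrix (\<lambda>i. 1 / sqrt (weighted_degree A i)) in mat 1 - S ** A ** S)"

text \<open>The eigenvalues are indexed by \<open>'n\<close>, repeated according to multiplicity, in any order.\<close>

definition orthonormal_eigenbasis :: "real^'n^'n \<Rightarrow> ('n \<Rightarrow> real) \<Rightarrow> real^'n^'n \<Rightarrow> bool" where
  "orthonormal_eigenbasis N \<omega> V \<longleftrightarrow>
     orthogonal_matrix V \<and> (\<forall>i. N *v column i V = \<omega> i *\<^sub>R column i V)"

definition spectral_filter :: "(real \<Rightarrow> real) \<Rightarrow> bool" where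
  "spectral_filter g \<longleftrightarrow>
     g \<in> {0..2} \<rightarrow> {0..1} \<and> antimono_on {0..2} g \<and> g 0 = 1 \<and> g 2 = 0"

text \<open>In the next two definitions \<open>l\<close> is the diagonal of \<open>\<Lambda>\<close>. The matrices \<open>T\<close> and
  \<open>K\<close> themselves are the case \<open>r = (\<lambda>t. t)\<close>.\<close>

definition fun_T :: "real^'n^'n \<Rightarrow> ('n \<Rightarrow> real) \<Rightarrow> (real \<Rightarrow> real) \<Rightarrow> real^'n^'n" where
  "fun_T V l r = V ** diag_matrix (\<lambda>i. r (l i)) ** transpose V"

definition fun_K ::
    "real^'n^'n \<Rightarrow> real^'n^'n \<Rightarrow> ('n \<Rightarrow> real) \<Rightarrow> (real \<Rightarrow> real) \<Rightarrow> real^'n^'n" where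
  "fun_K M V l r =
     matrix_inv M ** V ** diag_matrix (\<lambda>i. r (l i)) ** transpose V ** M"

lemma fun_T_id: "fun_T V l (\<lambda>t. t) = V ** diag_matrix l ** transpose V"
  by (simp add: fun_T_def)

lemma fun_K_id: "fun_K M V l (\<lambda>t. t) = matrix_inv M ** fun_T V l (\<lambda>t. t) ** M"
  by (simp add: fun_K_def fun_T_def matrix_mul_assoc)

text \<open>\<open>S\<close> is the set of points at which a polynomial under a square root must be nonnegative.\<close>

definition poly_or_sqrt_poly :: "real set \<Rightarrow> (real \<Rightarrow> real) \<Rightarrow> bool" where
  "poly_or_sqrt_poly S r \<longleftrightarrow>
     (\<exists>p :: real poly. r = poly p) \<or>
     (\<exists>p :: real poly. (\<forall>t\<in>S. 0 \<le> poly p t) \<and> r = (\<lambda>t. sqrt (poly p t)))"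

text \<open>Sums over families and family norms are taken in \<^typ>\<open>ennreal\<close>, so that a divergent sum or
  an unbounded supremum has the value \<open>\<infinity>\<close>.\<close>

definition sum_sq ::
    "(real^'n \<Rightarrow> real) \<Rightarrow> 'j set \<Rightarrow> ('j \<Rightarrow> real^'n^'n) \<Rightarrow> real^'n \<Rightarrow> ennreal" where
  "sum_sq nrm J B x = (\<Sum>\<^sub>\<infinity>j\<in>J. ennreal ((nrm (B j *v x))\<^sup>2))"

definition is_frame ::
    "(real^'n \<Rightarrow> real) \<Rightarrow> 'j set \<Rightarrow> ('j \<Rightarrow> real^'n^'n) \<Rightarrow> real \<Rightarrow> real \<Rightarrow> bool" where
  "is_frame nrm J B c C \<longleftrightarrow>
     countable J \<and> 0 < c \<and> c \<le> C \<and>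
     (\<forall>x. ennreal (c * (nrm x)\<^sup>2) \<le> sum_sq nrm J B x \<and>
          sum_sq nrm J B x \<le> ennreal (C * (nrm x)\<^sup>2))"

definition ennreal_sqrt :: "ennreal \<Rightarrow> ennreal" where
  "ennreal_sqrt t = (if t = \<infinity> then \<infinity> else ennreal (sqrt (enn2real t)))"

definition family_norm ::
    "(real^'n \<Rightarrow> real) \<Rightarrow> 'j set \<Rightarrow> ('j \<Rightarrow> real^'n^'n) \<Rightarrow> ennreal" where
  "family_norm nrm J B = (SUP x\<in>{x. nrm x = 1}. ennreal_sqrt (sum_sq nrm J B x))"

definition norm_wrt :: "real^'n^'n \<Rightarrow> real^'n \<Rightarrow> real" where
  "norm_wrt M x = norm (M *v x)"

definition op_norm :: "real^'n^'n \<Rightarrow> real" where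
  "op_norm X = onorm ((*v) X)"

definition kappa :: "real^'n^'n \<Rightarrow> real^'n^'n \<Rightarrow> real" where
  "kappa M M' =
     Max ((\<lambda>R. max (op_norm (mat 1 - R)) (op_norm (mat 1 - matrix_inv R)))
          ` {matrix_inv M ** M', M' ** matrix_inv M})"

end

theory Submission
  imports Defs
begin

text \<open>Put \<open>y = M x\<close> and \<open>R = M' M\<^sup>-\<^sup>1\<close>. Conjugation by \<open>M\<close> turns \<open>r(K) - r(K')\<close> into
  \<open>r(T) - R\<^sup>-\<^sup>1 r(T') R = (r(T) - r(T')) + r(T') (1 - R) + (1 - R\<^sup>-\<^sup>1) r(T') R\<close>.
  The frame bound \<open>C \<le> 1\<close> controls the last two summands, with \<open>\<parallel>R\<parallel> \<le> \<kappa> + 1\<close>, and the square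
  of a sum of three terms is at most three times the sum of the squares.\<close>

lemma op_norm_bound: "norm (X *v x) \<le> op_norm X * norm (x :: real^'n)"
  unfolding op_norm_def by (rule onorm) simp

lemma op_norm_nonneg: "0 \<le> op_norm X"
  unfolding op_norm_def by (rule onorm_pos_le) simp

lemma matrix_inv_mult_self:
  fixes M :: "real^'n^'n"
  assumes "invertible M"
  shows "M ** matrix_inv M = mat 1" "matrix_inv M ** M = mat 1"
  using someI_ex[OF assms[unfolded invertible_def]] unfolding matrix_inv_def by auto

text \<open>For square matrices a one-sided inverse is two-sided, so cancelling \<open>R\<close> on
  the left identifies \<open>S\<close>.\<close>

lemma matrix_inv_eqI:
  fixes R S :: "real^'n^'n"
  assumes "R ** S = mat 1"
  shows "matrix_inv R = S"
proof -
  have "invertible R"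
    using assms by (metis invertible_right_inverse)
  then have "matrix_inv R ** R ** S = S"
    by (simp add: matrix_inv_mult_self)
  with assms show ?thesis
    by (simp flip: matrix_mul_assoc)
qed

text \<open>\<open>M' ** matrix_inv M\<close> has inverse \<open>M ** matrix_inv M'\<close>, so both
  quantities occur in the maximum defining \<open>kappa\<close>.\<close>

lemma kappa_bounds:
  assumes "invertible M" "invertible M'"
  shows "op_norm (mat 1 - M' ** matrix_inv M) \<le> kappa M M'"
    and "op_norm (mat 1 - M ** matrix_inv M') \<le> kappa M M'"
proof -
  have "M' ** matrix_inv M ** (M ** matrix_inv M') = M' ** (matrix_inv M ** M) ** matrix_inv M'"
    by (simp add: matrix_mul_assoc)
  then have "matrix_inv (M' ** matrix_inv M) = M ** matrix_inv M'"
    using assms by (intro matrix_inv_eqI) (simp add: matrix_inv_mult_self)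
  then show "op_norm (mat 1 - M' ** matrix_inv M) \<le> kappa M M'"
    and "op_norm (mat 1 - M ** matrix_inv M') \<le> kappa M M'"
    unfolding kappa_def by auto
qed

lemma ennreal_sqrt_power2: "(ennreal_sqrt t)\<^sup>2 = t"
  unfolding ennreal_sqrt_def by (cases t) (auto simp: ennreal_power power_eq_top_ennreal)

lemma ennreal_sqrt_mono: "s \<le> t \<Longrightarrow> ennreal_sqrt s \<le> ennreal_sqrt t"
  unfolding ennreal_sqrt_def by (cases s; cases t) (auto intro: ennreal_leI simp: top_unique)

text \<open>\<open>ennreal_sqrt\<close> is monotone and its square is the identity, also at
  infinity, so a bound on unit vectors passes through the supremum; \<open>b\<close> may be
  infinite.\<close>

lemma family_norm_power2_le:
  assumes "\<And>x. nrm x = 1 \<Longrightarrow> sum_sq nrm J B x \<le> b"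
  shows "(family_norm nrm J B)\<^sup>2 \<le> b"
proof -
  have "family_norm nrm J B \<le> ennreal_sqrt b"
    unfolding family_norm_def using assms by (auto intro!: SUP_least ennreal_sqrt_mono)
  then have "(family_norm nrm J B)\<^sup>2 \<le> (ennreal_sqrt b)\<^sup>2"
    by (rule power_mono) simp
  then show ?thesis
    by (simp add: ennreal_sqrt_power2)
qed

lemma sum_sq_le_family_norm:
  assumes "nrm x = 1"
  shows "sum_sq nrm J B x \<le> (family_norm nrm J B)\<^sup>2"
proof -
  have "ennreal_sqrt (sum_sq nrm J B x) \<le> family_norm nrm J B"
    unfolding family_norm_def using assms by (auto intro: SUP_upper)
  then have "(ennreal_sqrt (sum_sq nrm J B x))\<^sup>2 \<le> (family_norm nrm J B)\<^sup>2"
    by (rule power_mono) simp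
  then show ?thesis
    by (simp add: ennreal_sqrt_power2)
qed

text \<open>All terms are nonnegative, so finite partial sums lie below the whole sum. With the
  converse \<open>sum_sq_leI\<close>, this lets the estimates be made on finite real sums.\<close>

lemma sum_le_sum_sq:
  assumes "finite F" "F \<subseteq> J"
  shows "ennreal (\<Sum>j\<in>F. (nrm (B j *v x))\<^sup>2) \<le> sum_sq nrm J B x"
proof -
  have "ennreal (\<Sum>j\<in>F. (nrm (B j *v x))\<^sup>2) = (\<Sum>\<^sub>\<infinity>j\<in>F. ennreal ((nrm (B j *v x))\<^sup>2))"
    using assms(1) by (simp add: sum_ennreal)
  also have "\<dots> \<le> sum_sq nrm J B x"
    unfolding sum_sq_def using assms(2)
    by (intro infsum_mono_neutral nonneg_summable_on_complete) auto
  finally show ?thesis .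
qed

lemma sum_sq_leI:
  assumes "\<And>F. finite F \<Longrightarrow> F \<subseteq> J \<Longrightarrow> ennreal (\<Sum>j\<in>F. (nrm (B j *v x))\<^sup>2) \<le> b"
  shows "sum_sq nrm J B x \<le> b"
  unfolding sum_sq_def using assms
  by (intro infsum_le_finite_sums nonneg_summable_on_complete) (auto simp: sum_ennreal)

text \<open>The upper frame bound is moved from \<open>ennreal\<close> to the reals, which is sound
  because \<open>0 < c\<close> and \<open>c \<le> C\<close> make its right-hand side nonnegative;
  then \<open>C \<le> 1\<close> absorbs the constant.\<close>

lemma is_frame_sum_le:
  assumes "is_frame norm J B c C" "C \<le> 1" "finite F" "F \<subseteq> J"
  shows "(\<Sum>j\<in>F. (norm (B j *v x))\<^sup>2) \<le> (norm x)\<^sup>2"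
proof -
  have "ennreal (\<Sum>j\<in>F. (norm (B j *v x))\<^sup>2) \<le> ennreal (C * (norm x)\<^sup>2)"
    using sum_le_sum_sq[OF assms(3,4)] assms(1) unfolding is_frame_def by (blast intro: order_trans)
  then have "(\<Sum>j\<in>F. (norm (B j *v x))\<^sup>2) \<le> C * (norm x)\<^sup>2"
    using assms(1) unfolding is_frame_def by (subst (asm) ennreal_le_iff) auto
  also have "\<dots> \<le> (norm x)\<^sup>2"
    using mult_right_mono[OF assms(2), of "(norm x)\<^sup>2"] by simp
  finally show ?thesis .
qed

text \<open>After the triangle inequality, each cross term \<open>2ab\<close> is at most
  \<open>a\<^sup>2 + b\<^sup>2\<close>, and each square occurs in two cross terms.\<close>

lemma norm_add3_power2_le:
  fixes a b c :: "'a::real_normed_vector"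
  shows "(norm (a + b + c))\<^sup>2 \<le> 3 * ((norm a)\<^sup>2 + (norm b)\<^sup>2 + (norm c)\<^sup>2)"
proof -
  have "norm (a + b + c) \<le> norm a + norm b + norm c"
    by (metis add_mono norm_triangle_ineq order_refl order_trans)
  then have "(norm (a + b + c))\<^sup>2 \<le> (norm a + norm b + norm c)\<^sup>2"
    by (rule power_mono) simp
  also have "\<dots> \<le> 3 * ((norm a)\<^sup>2 + (norm b)\<^sup>2 + (norm c)\<^sup>2)"
    using sum_squares_bound[of "norm a" "norm b"] sum_squares_bound[of "norm b" "norm c"]
      sum_squares_bound[of "norm a" "norm c"]
    by (simp add: power2_eq_square algebra_simps)
  finally show ?thesis .
qed

text \<open>\<open>M\<close> cancels the leading \<open>matrix_inv M\<close>: this intertwining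
  turns the \<open>M\<close>-norm of the \<open>K\<close> family into the Euclidean norm of the
  \<open>T\<close> family.\<close>

lemma matrix_mul_fun_K:
  assumes "invertible M"
  shows "M *v (fun_K M V l r *v x) = fun_T V l r *v (M *v x)"
proof -
  have "M ** fun_K M V l r = (M ** matrix_inv M) ** (fun_T V l r ** M)"
    by (simp add: fun_K_def fun_T_def matrix_mul_assoc)
  then show ?thesis
    using assms by (simp add: matrix_vector_mul_assoc matrix_inv_mult_self)
qed

theorem theorem4p3:
  fixes A A' M M' V V' :: "real^'n^'n"
    and \<omega> \<omega>' lam lam' :: "'n \<Rightarrow> real"
    and g :: "real \<Rightarrow> real"
    and J :: "'j set"
    and r :: "'j \<Rightarrow> real \<Rightarrow> real"
    and c c' C :: real
  assumes "weighted_connected_graph A" and "weighted_connected_graph A'"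
    and "orthonormal_eigenbasis (normalized_laplacian A) \<omega> V"
    and "orthonormal_eigenbasis (normalized_laplacian A') \<omega>' V'"
    and "spectral_filter g"
    and "\<And>i. lam i = g (\<omega> i)" and "\<And>i. lam' i = g (\<omega>' i)"
    and "invertible M" and "invertible M'"
    and "\<And>j. j \<in> J \<Longrightarrow> poly_or_sqrt_poly (range lam \<union> range lam') (r j)"
    and "is_frame norm J (\<lambda>j. fun_T V lam (r j)) c C"
    and "is_frame norm J (\<lambda>j. fun_T V' lam' (r j)) c' C"
    and "C \<le> 1"
  shows "(family_norm (norm_wrt M) J (\<lambda>j. fun_K M V lam (r j) - fun_K M' V' lam' (r j)))\<^sup>2
    \<le> 6 * ((family_norm norm J (\<lambda>j. fun_T V lam (r j) - fun_T V' lam' (r j)))\<^sup>2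
            + ennreal ((kappa M M')\<^sup>2 * (kappa M M' + 1)\<^sup>2))"
proof (intro family_norm_power2_le sum_sq_leI)
  fix x F
  assume "norm_wrt M x = 1" and F: "finite F" "F \<subseteq> J"
  define k where "k = kappa M M'"
  \<comment> \<open>In the notation of the overview, \<open>z\<close> is \<open>R\<close> applied to
    \<open>y\<close>, and \<open>S\<close> below is the inverse of \<open>R\<close>.\<close>
  define y z where "y = M *v x" and "z = M' *v x"
  define T T' where "T j = fun_T V lam (r j)" and "T' j = fun_T V' lam' (r j)" for j
  define S where "S = M ** matrix_inv M'"
  have y: "norm y = 1"
    using \<open>norm_wrt M x = 1\<close> by (simp add: norm_wrt_def y_def)
  note bounds = kappa_bounds[OF \<open>invertible M\<close> \<open>invertible M'\<close>, folded k_def]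
  have k: "0 \<le> k"
    using bounds(1) op_norm_nonneg order_trans by blast
  have "z = (M' ** matrix_inv M) *v y"
    using matrix_inv_mult_self(2)[OF \<open>invertible M\<close>]
    by (simp add: y_def z_def matrix_vector_mul_assoc flip: matrix_mul_assoc)
  then have "y - z = (mat 1 - M' ** matrix_inv M) *v y"
    by (simp add: matrix_vector_mult_diff_rdistrib)
  then have yz: "norm (y - z) \<le> k"
    using op_norm_bound[of "mat 1 - M' ** matrix_inv M" y] bounds(1) y by simp
  then have z: "norm z \<le> k + 1"
    using norm_triangle_ineq3[of y z] y by linarith
  \<comment> \<open>\<open>1 - S\<close> acts after \<open>T' j\<close>, so its norm must be
    extracted for each \<open>j\<close>. In the second term \<open>T' j\<close> acts on a vector
    independent of \<open>j\<close>, which the frame bound handles after summation.\<close>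
  have split: "(norm_wrt M ((fun_K M V lam (r j) - fun_K M' V' lam' (r j)) *v x))\<^sup>2
      \<le> 3 * ((norm ((T j - T' j) *v y))\<^sup>2 + (norm (T' j *v (y - z)))\<^sup>2
             + k\<^sup>2 * (norm (T' j *v z))\<^sup>2)" for j
  proof -
    have "S ** M' = M"
      using matrix_inv_mult_self(2)[OF \<open>invertible M'\<close>] by (simp add: S_def flip: matrix_mul_assoc)
    then have "M *v (fun_K M' V' lam' (r j) *v x) = S *v (M' *v (fun_K M' V' lam' (r j) *v x))"
      by (simp add: matrix_vector_mul_assoc matrix_mul_assoc)
    also have "\<dots> = S *v (T' j *v z)"
      using matrix_mul_fun_K[OF \<open>invertible M'\<close>, of V' lam' "r j" x]
      by (simp add: T'_def z_def)
    finally have conj: "M *v ((fun_K M V lam (r j) - fun_K M' V' lam' (r j)) *v x)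
        = (T j - T' j) *v y + T' j *v (y - z) + (mat 1 - S) *v (T' j *v z)"
      using matrix_mul_fun_K[OF \<open>invertible M\<close>, of V lam "r j" x]
      by (simp add: T_def y_def matrix_vector_mult_diff_rdistrib matrix_vector_mult_diff_distrib)
    have "norm ((mat 1 - S) *v (T' j *v z)) \<le> k * norm (T' j *v z)"
      using op_norm_bound[of "mat 1 - S" "T' j *v z"] bounds(2)
      by (metis S_def mult_right_mono norm_ge_zero order_trans)
    then have "(norm ((mat 1 - S) *v (T' j *v z)))\<^sup>2 \<le> k\<^sup>2 * (norm (T' j *v z))\<^sup>2"
      by (metis norm_ge_zero power_mono power_mult_distrib)
    then show ?thesis
      unfolding norm_wrt_def conj
      by (intro order_trans[OF norm_add3_power2_le] mult_left_mono add_left_mono) simp_all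
  qed
  define s where "s = (\<Sum>j\<in>F. (norm ((T j - T' j) *v y))\<^sup>2)"
  note frame = is_frame_sum_le[OF assms(12) \<open>C \<le> 1\<close> F, folded T'_def]
  have s0: "0 \<le> s"
    unfolding s_def by (intro sum_nonneg) simp
  have "(\<Sum>j\<in>F. (norm_wrt M ((fun_K M V lam (r j) - fun_K M' V' lam' (r j)) *v x))\<^sup>2)
      \<le> 3 * (s + (\<Sum>j\<in>F. (norm (T' j *v (y - z)))\<^sup>2) + k\<^sup>2 * (\<Sum>j\<in>F. (norm (T' j *v z))\<^sup>2))"
    using sum_mono[of F, OF split] unfolding s_def
    by (simp add: sum.distrib flip: sum_distrib_left)
  also have "\<dots> \<le> 3 * (s + k\<^sup>2 + k\<^sup>2 * (k + 1)\<^sup>2)"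
  proof -
    have "(norm (y - z))\<^sup>2 \<le> k\<^sup>2" "(norm z)\<^sup>2 \<le> (k + 1)\<^sup>2"
      using yz z by (simp_all add: power_mono)
    \<comment> \<open>The frame bound for \<open>T'\<close> is applied at the two fixed vectors
      \<open>y - z\<close> and \<open>z\<close>.\<close>
    then have "(\<Sum>j\<in>F. (norm (T' j *v (y - z)))\<^sup>2) \<le> k\<^sup>2" "(\<Sum>j\<in>F. (norm (T' j *v z))\<^sup>2) \<le> (k + 1)\<^sup>2"
      using frame order_trans by blast+
    then show ?thesis
      by (intro mult_left_mono add_mono) auto
  qed
  also have "\<dots> \<le> 6 * (s + k\<^sup>2 * (k + 1)\<^sup>2)"
  proof -
    \<comment> \<open>As \<open>k \<ge> 0\<close>, the lone \<open>k\<^sup>2\<close> is absorbed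
      into a second copy of \<open>k\<^sup>2 * (k + 1)\<^sup>2\<close>; this doubles the factor 3 to
      6, and \<open>3 * s\<close> is relaxed to \<open>6 * s\<close>.\<close>
    have "k\<^sup>2 * 1 \<le> k\<^sup>2 * (k + 1)\<^sup>2"
      using k by (intro mult_left_mono) (auto intro: one_le_power)
    then show ?thesis
      using s0 by simp
  qed
  finally have "ennreal (\<Sum>j\<in>F. (norm_wrt M ((fun_K M V lam (r j) - fun_K M' V' lam' (r j)) *v x))\<^sup>2)
      \<le> ennreal (6 * (s + k\<^sup>2 * (k + 1)\<^sup>2))"
    by (rule ennreal_leI)
  also have "\<dots> = 6 * (ennreal s + ennreal (k\<^sup>2 * (k + 1)\<^sup>2))"
    using s0 by (subst ennreal_mult) (auto simp del: distrib_left_numeral)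
  \<comment> \<open>\<open>y\<close> is a Euclidean unit vector, so the partial sum \<open>s\<close>
    is bounded by the squared supremum, which may be infinite a priori.\<close>
  also have "ennreal s \<le> (family_norm norm J (\<lambda>j. T j - T' j))\<^sup>2"
    unfolding s_def using sum_le_sum_sq[OF F] sum_sq_le_family_norm[of norm, OF y] by (rule order_trans)
  finally show "ennreal (\<Sum>j\<in>F. (norm_wrt M ((fun_K M V lam (r j) - fun_K M' V' lam' (r j)) *v x))\<^sup>2)
      \<le> 6 * ((family_norm norm J (\<lambda>j. fun_T V lam (r j) - fun_T V' lam' (r j)))\<^sup>2
              + ennreal ((kappa M M')\<^sup>2 * (kappa M M' + 1)\<^sup>2))"
    by (simp add: T_def T'_def k_def add_right_mono mult_left_mono)
qed

end
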